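(* Let $M$ be a monoid, $\theta:M\to M$ a monoid endomorphism, and let $S=\mathrm{BR}(M,\theta)$ be the Bruck--Reilly extension of $M$. If $S$ is right coherent, then so is $M$.
   Context: For a monoid $M$ and a (monoid, i.e. identity-preserving) endomorphism $\theta:M\to M$, the Bruck--Reilly extension $\mathrm{BR}(M,\theta)$ is the monoid with underlying set $\mathbb{N}_0\times M\times\mathbb{N}_0$ (where $\mathbb{N}_0=\{0,1,2,\dots\}$) and multiplication \[(a,g,b)(c,h,d)=\bigl(a-b+t,\ (g\theta^{t-b})(h\theta^{t-c}),\ d-c+t\bigr),\qquad t=\max\{b,c\},\] where maps are written on the right and $\theta^0$ is the identity map. Let $S$ be a monoid. A right $S$-act is a set $A$ with a map $A\times S\to A$, $(a,s)\mapsto as$, with $a1=a$ and $a(st)=(as)t$. The free right $S$-act on a set $X$ is $F_S(X)=X\times S$ with $(x,s)t=(x,st)$. A congruence on a right $S$-act is an equivalence relation preserved by the action; it is finitely generated if it is the smallest congruence containing some finite set of pairs. An act $A$ is finitely generated if $A=a_1S\cup\dots\cup a_nS$ for some $a_i\in A$, and finitely presented if it is isomorphic to $F_S(X)/\rho$ with $X$ finite and $\rho$ a finitely generated congruence. The empty set is allowed as a subact (and is finitely generated). The monoid $S$ is right coherent if every finitely generated subact of every finitely presented right $S$-act is finitely presented. *)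

theory Defs
  imports "HOL-Algebra.Group"
begin

subsection \<open>Bruck--Reilly extensions\<close>

(* With t = max b c the exponents t - b, t - c are nonnegative, so truncated subtraction on nat
   is exact; a - b + t is written a + (t - b), since a - b itself could be negative. *)
definition bruck_reilly :: "('a, 'm) monoid_scheme \<Rightarrow> ('a \<Rightarrow> 'a) \<Rightarrow> (nat \<times> 'a \<times> nat) monoid" where
  "bruck_reilly M \<theta> =
     \<lparr>carrier = UNIV \<times> carrier M \<times> UNIV,
      mult = (\<lambda>(a, g, b) (c, h, d). let t = max b c in
                (a + (t - b), (\<theta> ^^ (t - b)) g \<otimes>\<^bsub>M\<^esub> (\<theta> ^^ (t - c)) h, d + (t - c))),
      one = (0, \<one>\<^bsub>M\<^esub>, 0)\<rparr>"

(* hom for monoids does not require preservation of the identity *)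
definition monoid_endo :: "('a, 'm) monoid_scheme \<Rightarrow> ('a \<Rightarrow> 'a) \<Rightarrow> bool" where
  "monoid_endo M \<theta> \<longleftrightarrow> \<theta> \<in> hom M M \<and> \<theta> \<one>\<^bsub>M\<^esub> = \<one>\<^bsub>M\<^esub>"


subsection \<open>Right acts\<close>

(* An act is a carrier A together with an action; A may be empty. *)
locale right_act = monoid S for S :: "('a, 'm) monoid_scheme" (structure) +
  fixes A :: "'b set" and act :: "'b \<Rightarrow> 'a \<Rightarrow> 'b"
  assumes act_closed: "\<lbrakk>a \<in> A; s \<in> carrier S\<rbrakk> \<Longrightarrow> act a s \<in> A"
    and act_one: "a \<in> A \<Longrightarrow> act a \<one> = a"
    and act_mult: "\<lbrakk>a \<in> A; s \<in> carrier S; t \<in> carrier S\<rbrakk> \<Longrightarrow> act a (s \<otimes> t) = act (act a s) t"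

definition subact :: "('a, 'm) monoid_scheme \<Rightarrow> 'b set \<Rightarrow> ('b \<Rightarrow> 'a \<Rightarrow> 'b) \<Rightarrow> 'b set \<Rightarrow> bool" where
  "subact S A act B \<longleftrightarrow> B \<subseteq> A \<and> (\<forall>b\<in>B. \<forall>s\<in>carrier S. act b s \<in> B)"

definition act_fin_generated :: "('a, 'm) monoid_scheme \<Rightarrow> 'b set \<Rightarrow> ('b \<Rightarrow> 'a \<Rightarrow> 'b) \<Rightarrow> bool" where
  "act_fin_generated S A act \<longleftrightarrow>
     (\<exists>F. finite F \<and> F \<subseteq> A \<and> A = (\<Union>a\<in>F. {act a s | s. s \<in> carrier S}))"

definition act_iso ::
    "('a, 'm) monoid_scheme \<Rightarrow> 'b set \<Rightarrow> ('b \<Rightarrow> 'a \<Rightarrow> 'b) \<Rightarrow> 'c set \<Rightarrow> ('c \<Rightarrow> 'a \<Rightarrow> 'c) \<Rightarrow> ('b \<Rightarrow> 'c) \<Rightarrow> bool"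
  where
  "act_iso S A act B act' \<phi> \<longleftrightarrow>
     bij_betw \<phi> A B \<and> (\<forall>a\<in>A. \<forall>s\<in>carrier S. \<phi> (act a s) = act' (\<phi> a) s)"


subsection \<open>Congruences, quotients and finite presentability\<close>

definition act_congruence ::
    "('a, 'm) monoid_scheme \<Rightarrow> 'b set \<Rightarrow> ('b \<Rightarrow> 'a \<Rightarrow> 'b) \<Rightarrow> ('b \<times> 'b) set \<Rightarrow> bool" where
  "act_congruence S A act \<rho> \<longleftrightarrow>
     equiv A \<rho> \<and> (\<forall>(a, b)\<in>\<rho>. \<forall>s\<in>carrier S. (act a s, act b s) \<in> \<rho>)"

definition congruence_fin_generated ::
    "('a, 'm) monoid_scheme \<Rightarrow> 'b set \<Rightarrow> ('b \<Rightarrow> 'a \<Rightarrow> 'b) \<Rightarrow> ('b \<times> 'b) set \<Rightarrow> bool" where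
  "congruence_fin_generated S A act \<rho> \<longleftrightarrow>
     act_congruence S A act \<rho> \<and>
     (\<exists>R. finite R \<and> R \<subseteq> \<rho> \<and> (\<forall>\<sigma>. act_congruence S A act \<sigma> \<and> R \<subseteq> \<sigma> \<longrightarrow> \<rho> \<subseteq> \<sigma>))"

(* the action on A // \<rho>: on a class C of a congruence this is the class of act c s, for any c in C *)
definition quotient_action ::
    "('b \<Rightarrow> 'a \<Rightarrow> 'b) \<Rightarrow> ('b \<times> 'b) set \<Rightarrow> 'b set \<Rightarrow> 'a \<Rightarrow> 'b set" where
  "quotient_action act \<rho> C s = (\<Union>c\<in>C. \<rho> `` {act c s})"

definition free_act :: "('a, 'm) monoid_scheme \<Rightarrow> 'x set \<Rightarrow> ('x \<times> 'a) set" where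
  "free_act S X = X \<times> carrier S"

definition free_action :: "('a, 'm) monoid_scheme \<Rightarrow> 'x \<times> 'a \<Rightarrow> 'a \<Rightarrow> 'x \<times> 'a" where
  "free_action S = (\<lambda>(x, s) t. (x, s \<otimes>\<^bsub>S\<^esub> t))"

(* Finite generating sets X are taken inside nat, which loses nothing up to bijection. *)
definition act_fin_presented :: "('a, 'm) monoid_scheme \<Rightarrow> 'b set \<Rightarrow> ('b \<Rightarrow> 'a \<Rightarrow> 'b) \<Rightarrow> bool" where
  "act_fin_presented S A act \<longleftrightarrow>
     (\<exists>(X :: nat set) \<rho> \<phi>. finite X \<and>
        congruence_fin_generated S (free_act S X) (free_action S) \<rho> \<and>
        act_iso S A act (free_act S X // \<rho>) (quotient_action (free_action S) \<rho>) \<phi>)"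


subsection \<open>Right coherence\<close>

(* A definition cannot quantify over all types, so the acts range over the sets of the one type
   (nat \<times> 'a) set, which contains every F_S(X)/\<rho> with X a finite set of naturals and hence a copy of
   every finitely presented act. Lemma right_coherentD shows that the property then holds for
   acts of arbitrary type. *)
definition right_coherent :: "('a, 'm) monoid_scheme \<Rightarrow> bool" where
  "right_coherent S \<longleftrightarrow>
     (\<forall>(A :: (nat \<times> 'a) set set) act. right_act S A act \<and> act_fin_presented S A act \<longrightarrow>
        (\<forall>B. subact S A act B \<and> act_fin_generated S B act \<longrightarrow> act_fin_presented S B act))"


subsection \<open>Consistency of the definitions\<close>

lemma monoid_endo_funpow:
  assumes "monoid M" "monoid_endo M \<theta>"
  shows "monoid_endo M (\<theta> ^^ n)"
  using assms by (induction n) (auto simp: monoid_endo_def hom_def Pi_iff)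

lemma monoid_bruck_reilly:
  assumes M: "monoid M" and \<theta>: "monoid_endo M \<theta>"
  shows "monoid (bruck_reilly M \<theta>)"
proof -
  interpret monoid M by fact
  have cl: "(\<theta> ^^ n) x \<in> carrier M" if "x \<in> carrier M" for n x
    using monoid_endo_funpow[OF M \<theta>, of n] that by (auto simp: monoid_endo_def hom_def)
  have mu: "(\<theta> ^^ n) (x \<otimes>\<^bsub>M\<^esub> y) = (\<theta> ^^ n) x \<otimes>\<^bsub>M\<^esub> (\<theta> ^^ n) y"
    if "x \<in> carrier M" "y \<in> carrier M" for n x y
    using monoid_endo_funpow[OF M \<theta>, of n] that by (auto simp: monoid_endo_def hom_def)
  have on: "(\<theta> ^^ n) \<one>\<^bsub>M\<^esub> = \<one>\<^bsub>M\<^esub>" for n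
    using monoid_endo_funpow[OF M \<theta>, of n] by (auto simp: monoid_endo_def)
  have ad: "(\<theta> ^^ m) ((\<theta> ^^ n) x) = (\<theta> ^^ (m + n)) x" for m n x
    by (simp add: funpow_add)
  show ?thesis
  proof (rule monoidI, goal_cases)
    case (3 x y z)
    obtain a g b where x: "x = (a, g, b)" by (cases x)
    obtain c h d where y: "y = (c, h, d)" by (cases y)
    obtain e k f where z: "z = (e, k, f)" by (cases z)
    have G: "g \<in> carrier M" "h \<in> carrier M" "k \<in> carrier M"
      using 3 by (auto simp: x y z bruck_reilly_def)
    define t where "t = max b c"
    define u where "u = max d e"
    define v where "v = max (d + (t - c)) e"
    define w where "w = max b (c + (u - d))"
    obtain p where p: "c = b + p \<or> b = c + p" by (metis le_Suc_ex nat_le_linear)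
    obtain q where q: "d = e + q \<or> e = d + q" by (metis le_Suc_ex nat_le_linear)
    have "v - (d + (t - c)) + (t - b) = w - b \<and>
          v - (d + (t - c)) + (t - c) = w - (c + (u - d)) + (u - d) \<and>
          v - e = w - (c + (u - d)) + (u - e)"
      using p q unfolding t_def u_def v_def w_def by (elim disjE; simp add: max_def)
    then have e1: "v - (d + (t - c)) + (t - b) = w - b"
      and e2: "v - (d + (t - c)) + (t - c) = w - (c + (u - d)) + (u - d)"
      and e3: "v - e = w - (c + (u - d)) + (u - e)" by blast+
    have e4: "a + (t - b) + (v - (d + (t - c))) = a + (w - b)" using e1 by simp
    have e5: "f + (v - e) = f + (u - e) + (w - (c + (u - d)))" using e3 by simp
    have "(\<theta> ^^ (v - (d + (t - c)))) ((\<theta> ^^ (t - b)) g \<otimes>\<^bsub>M\<^esub> (\<theta> ^^ (t - c)) h) \<otimes>\<^bsub>M\<^esub> (\<theta> ^^ (v - e)) k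
        = (\<theta> ^^ (w - b)) g \<otimes>\<^bsub>M\<^esub> (\<theta> ^^ (w - (c + (u - d)))) ((\<theta> ^^ (u - d)) h \<otimes>\<^bsub>M\<^esub> (\<theta> ^^ (u - e)) k)"
      by (simp only: mu cl G ad e1 e2 e3 m_assoc m_closed)
    with e4 e5 show ?case
      by (simp only: x y z bruck_reilly_def Let_def monoid.simps partial_object.simps prod.case
          t_def[symmetric] u_def[symmetric] v_def[symmetric] w_def[symmetric])
  qed (auto simp: bruck_reilly_def Let_def cl on)
qed

lemma right_act_quotient:
  assumes "right_act S A act" and cong: "act_congruence S A act \<rho>"
  shows "right_act S (A // \<rho>) (quotient_action act \<rho>)"
proof -
  interpret right_act S A act by fact
  have eq: "equiv A \<rho>" and c: "\<And>a b s. (a, b) \<in> \<rho> \<Longrightarrow> s \<in> carrier S \<Longrightarrow> (act a s, act b s) \<in> \<rho>"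
    using cong by (auto simp: act_congruence_def)
  have q: "quotient_action act \<rho> (\<rho> `` {a}) s = \<rho> `` {act a s}"
    if "a \<in> A" "s \<in> carrier S" for a s
  proof -
    have "\<rho> `` {act b s} = \<rho> `` {act a s}" if "b \<in> \<rho> `` {a}" for b
      using equiv_class_eq[OF eq] c that \<open>s \<in> carrier S\<close> by blast
    moreover have "a \<in> \<rho> `` {a}" using equiv_class_self[OF eq \<open>a \<in> A\<close>] .
    ultimately show ?thesis unfolding quotient_action_def by blast
  qed
  show ?thesis
    by unfold_locales (auto elim!: quotientE simp: q act_closed act_one act_mult quotientI)
qed

lemma right_act_free:
  assumes "monoid S"
  shows "right_act S (free_act S X) (free_action S)"
proof -
  interpret monoid S by fact
  show ?thesis by unfold_locales (auto simp: free_act_def free_action_def m_assoc)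
qed

lemma act_fin_presented_iso:
  assumes "act_iso S A act B act' \<phi>" "act_fin_presented S B act'"
  shows "act_fin_presented S A act"
proof -
  obtain X :: "nat set" and \<rho> \<psi> where X: "finite X"
    "congruence_fin_generated S (free_act S X) (free_action S) \<rho>"
    "act_iso S B act' (free_act S X // \<rho>) (quotient_action (free_action S) \<rho>) \<psi>"
    using assms(2) by (auto simp: act_fin_presented_def)
  have "act_iso S A act (free_act S X // \<rho>) (quotient_action (free_action S) \<rho>) (\<psi> \<circ> \<phi>)"
    using assms(1) X(3) by (auto simp: act_iso_def intro: bij_betw_trans dest: bij_betwE)
  with X(1,2) show ?thesis unfolding act_fin_presented_def by blast
qed

lemma right_coherentD:
  fixes A :: "'b set"
  assumes S: "right_coherent S" and A: "right_act S A act" and fp: "act_fin_presented S A act"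
    and B: "subact S A act B" and fg: "act_fin_generated S B act"
  shows "act_fin_presented S B act"
proof -
  interpret right_act S A act by fact
  obtain X :: "nat set" and \<rho> \<phi> where X: "finite X"
    and \<rho>: "congruence_fin_generated S (free_act S X) (free_action S) \<rho>"
    and \<phi>: "act_iso S A act (free_act S X // \<rho>) (quotient_action (free_action S) \<rho>) \<phi>"
    using fp by (auto simp: act_fin_presented_def)
  let ?Q = "free_act S X // \<rho>" and ?q = "quotient_action (free_action S) \<rho>"
  have bij: "bij_betw \<phi> A ?Q"
    and eqv: "\<And>a s. a \<in> A \<Longrightarrow> s \<in> carrier S \<Longrightarrow> \<phi> (act a s) = ?q (\<phi> a) s"
    using \<phi> by (auto simp: act_iso_def)
  have BA: "B \<subseteq> A" and Bc: "\<And>b s. b \<in> B \<Longrightarrow> s \<in> carrier S \<Longrightarrow> act b s \<in> B"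
    using B by (auto simp: subact_def)
  have "right_act S ?Q ?q"
    using right_act_quotient[OF right_act_free[OF monoid_axioms]] \<rho>
    by (auto simp: congruence_fin_generated_def)
  moreover have "act_iso S ?Q ?q ?Q ?q id" by (simp add: act_iso_def)
  then have "act_fin_presented S ?Q ?q"
    unfolding act_fin_presented_def using X \<rho> by blast
  moreover have "subact S ?Q ?q (\<phi> ` B)"
    unfolding subact_def
  proof (intro conjI ballI)
    show "\<phi> ` B \<subseteq> ?Q" using BA bij by (auto simp: bij_betw_def)
    fix y s assume "y \<in> \<phi> ` B" "s \<in> carrier S"
    then obtain b where "b \<in> B" "y = \<phi> b" by blast
    with eqv[of b s] BA Bc \<open>s \<in> carrier S\<close> show "?q y s \<in> \<phi> ` B"
      by (metis image_eqI subsetD)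
  qed
  moreover have "act_fin_generated S (\<phi> ` B) ?q"
  proof -
    obtain F where F: "finite F" "F \<subseteq> B" "B = (\<Union>a\<in>F. {act a s | s. s \<in> carrier S})"
      using fg by (auto simp: act_fin_generated_def)
    have "\<phi> ` {act a s | s. s \<in> carrier S} = {?q (\<phi> a) s | s. s \<in> carrier S}" if "a \<in> F" for a
    proof -
      have "a \<in> A" using that F(2) BA by blast
      then have "\<And>s. s \<in> carrier S \<Longrightarrow> \<phi> (act a s) = ?q (\<phi> a) s" by (rule eqv)
      then show ?thesis by (force simp: image_def)
    qed
    then have "\<phi> ` B = (\<Union>a\<in>F. {?q (\<phi> a) s | s. s \<in> carrier S})"
      by (subst F(3)) (simp add: image_UN)
    then have "\<phi> ` B = (\<Union>y\<in>\<phi> ` F. {?q y s | s. s \<in> carrier S})" by simp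
    with F(1,2) show ?thesis unfolding act_fin_generated_def
      by (intro exI[of _ "\<phi> ` F"] conjI finite_imageI image_mono)
  qed
  ultimately have "act_fin_presented S (\<phi> ` B) ?q"
    using S by (auto simp: right_coherent_def)
  moreover have "act_iso S B act (\<phi> ` B) ?q \<phi>"
    using bij BA eqv by (auto simp: act_iso_def bij_betw_def intro: inj_on_subset)
  ultimately show ?thesis by (rule act_fin_presented_iso[rotated])
qed

end

theory Submission
  imports Defs
begin

text \<open>Write \<open>S\<close> for the Bruck--Reilly extension. The triples \<open>(a, g, b)\<close> with \<open>a > 0\<close> form a
  right ideal, and a triple \<open>(0, g, b)\<close> times \<open>(c, h, d)\<close> lies outside it only if \<open>c \<le> b\<close>, when it is
  \<open>(0, g (h \<theta>\<^bsup>b - c\<^esup>), d - c + b)\<close>. Hence every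
  \<open>M\<close>-congruence \<open>\<rho>\<close> on \<open>F\<^sub>M(X)\<close> is the trace at \<open>a = b = 0\<close> of an \<open>S\<close>-congruence on \<open>F\<^sub>S(X)\<close>: apply \<open>\<rho>\<close> to the middle components when \<open>a = 0\<close>, keep \<open>b\<close>, and collapse
  all that has \<open>a > 0\<close>. That congruence need not be finitely generated, but it contains
  the one generated by the relations of \<open>F\<^sub>M(X)/\<rho>\<close>, so the \<open>S\<close>-act \<open>Q\<close> with the same presentation contains
  \<open>F\<^sub>M(X)/\<rho>\<close>. A finite subset of \<open>F\<^sub>M(X)/\<rho>\<close> generates a finitely presented \<open>S\<close>-subact of \<open>Q\<close>, and the
  middle components of those defining relations that have \<open>a = 0\<close> present the \<open>M\<close>-subact.\<close>

subsection \<open>Congruences on acts\<close>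

lemma act_congruenceI:
  assumes "equiv A \<rho>"
    and "\<And>a b s. \<lbrakk>(a, b) \<in> \<rho>; s \<in> carrier S\<rbrakk> \<Longrightarrow> (act a s, act b s) \<in> \<rho>"
  shows "act_congruence S A act \<rho>"
  using assms by (auto simp: act_congruence_def)

lemma act_congruence_equiv: "act_congruence S A act \<rho> \<Longrightarrow> equiv A \<rho>"
  by (simp add: act_congruence_def)

lemma act_congruence_act:
  "\<lbrakk>act_congruence S A act \<rho>; (a, b) \<in> \<rho>; s \<in> carrier S\<rbrakk> \<Longrightarrow> (act a s, act b s) \<in> \<rho>"
  by (auto simp: act_congruence_def)

text \<open>Pullback along a map compatible with the actions through a change of monoid
  \<open>\<iota>\<close>. With \<open>\<iota> = id\<close> it moves relations between acts over one
  monoid; with an embedding of \<open>M\<close> it brings congruences over the Bruck--Reilly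
  extension down to \<open>M\<close>.\<close>

lemma act_congruence_vimage:
  assumes \<sigma>: "act_congruence S B act' \<sigma>"
    and closed: "\<And>a t. \<lbrakk>a \<in> A; t \<in> carrier T\<rbrakk> \<Longrightarrow> act a t \<in> A"
    and h: "\<And>a. a \<in> A \<Longrightarrow> h a \<in> B"
    and \<iota>: "\<And>t. t \<in> carrier T \<Longrightarrow> \<iota> t \<in> carrier S"
    and hom: "\<And>a t. \<lbrakk>a \<in> A; t \<in> carrier T\<rbrakk> \<Longrightarrow> h (act a t) = act' (h a) (\<iota> t)"
  shows "act_congruence T A act {(u, v). u \<in> A \<and> v \<in> A \<and> (h u, h v) \<in> \<sigma>}"
proof (rule act_congruenceI)
  have eq: "equiv B \<sigma>" using \<sigma> by (rule act_congruence_equiv)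
  show "equiv A {(u, v). u \<in> A \<and> v \<in> A \<and> (h u, h v) \<in> \<sigma>}"
  proof (rule equivI)
    show "refl_on A {(u, v). u \<in> A \<and> v \<in> A \<and> (h u, h v) \<in> \<sigma>}"
      using eq h by (auto simp: equiv_def refl_on_def)
    show "sym {(u, v). u \<in> A \<and> v \<in> A \<and> (h u, h v) \<in> \<sigma>}"
      using eq by (auto simp: equiv_def sym_def)
    show "trans {(u, v). u \<in> A \<and> v \<in> A \<and> (h u, h v) \<in> \<sigma>}"
      using eq by (auto simp: equiv_def intro!: transI dest: transD)
  qed auto
qed (auto simp: closed hom intro!: act_congruence_act[OF \<sigma>] \<iota>)

text \<open>If \<open>R\<close> is not inside \<open>A \<times> A\<close>, no congruence contains it
  and the intersection is \<open>UNIV\<close>; hence the hypothesis of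
  \<open>act_congruence_generated\<close>.\<close>

definition congruence_generated ::
    "('a, 'm) monoid_scheme \<Rightarrow> 'b set \<Rightarrow> ('b \<Rightarrow> 'a \<Rightarrow> 'b) \<Rightarrow> ('b \<times> 'b) set \<Rightarrow> ('b \<times> 'b) set" where
  "congruence_generated S A act R = \<Inter>{\<sigma>. act_congruence S A act \<sigma> \<and> R \<subseteq> \<sigma>}"

lemma congruence_generated_incl: "R \<subseteq> congruence_generated S A act R"
  by (auto simp: congruence_generated_def)

lemma congruence_generated_least:
  "\<lbrakk>act_congruence S A act \<sigma>; R \<subseteq> \<sigma>\<rbrakk> \<Longrightarrow> congruence_generated S A act R \<subseteq> \<sigma>"
  by (auto simp: congruence_generated_def)

lemma (in right_act) act_congruence_generated:
  assumes "R \<subseteq> A \<times> A"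
  shows "act_congruence S A act (congruence_generated S A act R)"
proof (rule act_congruenceI)
  \<comment> \<open>The total relation shows that the intersected family is nonempty, which keeps
    the intersection inside \<open>A \<times> A\<close>.\<close>
  have "act_congruence S A act (A \<times> A)"
    by (rule act_congruenceI) (auto simp: act_closed equiv_def refl_on_def sym_def trans_def)
  then have sub: "congruence_generated S A act R \<subseteq> A \<times> A"
    using assms by (rule congruence_generated_least)
  show "equiv A (congruence_generated S A act R)"
  proof (rule equivI)
    show "refl_on A (congruence_generated S A act R)"
      unfolding congruence_generated_def refl_on_def
      by (auto dest!: act_congruence_equiv simp: equiv_def refl_on_def)
    show "sym (congruence_generated S A act R)"
      unfolding congruence_generated_def
    proof (rule symI)
      fix x y
      assume xy: "(x, y) \<in> \<Inter>{\<sigma>. act_congruence S A act \<sigma> \<and> R \<subseteq> \<sigma>}"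
      have "(y, x) \<in> \<sigma>" if "act_congruence S A act \<sigma>" "R \<subseteq> \<sigma>" for \<sigma>
        using act_congruence_equiv[OF that(1)] xy that unfolding equiv_def
        by (blast dest: symD)
      then show "(y, x) \<in> \<Inter>{\<sigma>. act_congruence S A act \<sigma> \<and> R \<subseteq> \<sigma>}" by blast
    qed
    show "trans (congruence_generated S A act R)"
      unfolding congruence_generated_def
    proof (rule transI)
      fix x y z
      assume xy: "(x, y) \<in> \<Inter>{\<sigma>. act_congruence S A act \<sigma> \<and> R \<subseteq> \<sigma>}"
        and yz: "(y, z) \<in> \<Inter>{\<sigma>. act_congruence S A act \<sigma> \<and> R \<subseteq> \<sigma>}"
      have "(x, z) \<in> \<sigma>" if "act_congruence S A act \<sigma>" "R \<subseteq> \<sigma>" for \<sigma>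
        using act_congruence_equiv[OF that(1)] xy yz that unfolding equiv_def
        by (blast dest: transD)
      then show "(x, z) \<in> \<Inter>{\<sigma>. act_congruence S A act \<sigma> \<and> R \<subseteq> \<sigma>}" by blast
    qed
  qed (rule sub)
next
  fix a b s
  assume "(a, b) \<in> congruence_generated S A act R" "s \<in> carrier S"
  then show "(act a s, act b s) \<in> congruence_generated S A act R"
    unfolding congruence_generated_def by (blast dest: act_congruence_act)
qed

lemma (in right_act) congruence_fin_generated_generated:
  assumes "finite R" "R \<subseteq> A \<times> A"
  shows "congruence_fin_generated S A act (congruence_generated S A act R)"
  unfolding congruence_fin_generated_def
proof (intro conjI exI[of _ R] allI impI)
qed (use assms in \<open>auto simp: act_congruence_generated congruence_generated_incl
  dest: congruence_generated_least[THEN subsetD]\<close>)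

lemma congruence_fin_generatedE:
  assumes "congruence_fin_generated S A act \<rho>"
  obtains R where "act_congruence S A act \<rho>" "finite R" "R \<subseteq> \<rho>"
    "\<And>\<sigma>. \<lbrakk>act_congruence S A act \<sigma>; R \<subseteq> \<sigma>\<rbrakk> \<Longrightarrow> \<rho> \<subseteq> \<sigma>"
proof -
  from assms obtain R where "act_congruence S A act \<rho>" "finite R" "R \<subseteq> \<rho>"
    and "\<forall>\<sigma>. act_congruence S A act \<sigma> \<and> R \<subseteq> \<sigma> \<longrightarrow> \<rho> \<subseteq> \<sigma>"
    unfolding congruence_fin_generated_def by (elim conjE exE)
  then show ?thesis by (intro that[of R]) simp_all
qed

lemma quotient_action_class:
  assumes \<rho>: "act_congruence S A act \<rho>" and "a \<in> A" "s \<in> carrier S"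
  shows "quotient_action act \<rho> (\<rho> `` {a}) s = \<rho> `` {act a s}"
proof -
  have eq: "equiv A \<rho>" using \<rho> by (rule act_congruence_equiv)
  have "\<rho> `` {act b s} = \<rho> `` {act a s}" if "b \<in> \<rho> `` {a}" for b
    using equiv_class_eq[OF eq] act_congruence_act[OF \<rho> _ \<open>s \<in> carrier S\<close>] that by blast
  moreover have "a \<in> \<rho> `` {a}" using equiv_class_self[OF eq \<open>a \<in> A\<close>] .
  ultimately show ?thesis unfolding quotient_action_def by blast
qed


subsection \<open>Finite presentability in terms of a given generating family\<close>

text \<open>When the target is an act containing the values of \<open>f\<close>, this is the unique
  act homomorphism from the free act that sends \<open>(x, \<one>)\<close> to
  \<open>f x\<close>.\<close>

definition free_lift :: "('b \<Rightarrow> 'a \<Rightarrow> 'b) \<Rightarrow> ('x \<Rightarrow> 'b) \<Rightarrow> 'x \<times> 'a \<Rightarrow> 'b" where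
  "free_lift act f = (\<lambda>(x, s). act (f x) s)"

lemma free_lift_apply [simp]: "free_lift act f (x, s) = act (f x) s"
  by (simp add: free_lift_def)

definition free_kernel ::
    "('a, 'm) monoid_scheme \<Rightarrow> 'x set \<Rightarrow> ('b \<Rightarrow> 'a \<Rightarrow> 'b) \<Rightarrow> ('x \<Rightarrow> 'b) \<Rightarrow> (('x \<times> 'a) \<times> ('x \<times> 'a)) set"
  where
  "free_kernel S X act f =
     {(u, v). u \<in> free_act S X \<and> v \<in> free_act S X \<and> free_lift act f u = free_lift act f v}"

lemma mem_free_act [simp]: "(x, s) \<in> free_act S X \<longleftrightarrow> x \<in> X \<and> s \<in> carrier S"
  by (simp add: free_act_def)

lemma free_action_apply [simp]: "free_action S (x, s) t = (x, s \<otimes>\<^bsub>S\<^esub> t)"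
  by (simp add: free_action_def)

lemma free_actE:
  assumes "u \<in> free_act S X"
  obtains x s where "u = (x, s)" "x \<in> X" "s \<in> carrier S"
  using assms by (auto simp: free_act_def)

context right_act
begin

lemma free_action_closed:
  "\<lbrakk>u \<in> free_act S X; s \<in> carrier S\<rbrakk> \<Longrightarrow> free_action S u s \<in> free_act S X"
  by (auto elim!: free_actE)

lemma free_lift_closed:
  "\<lbrakk>f \<in> X \<rightarrow> A; u \<in> free_act S X\<rbrakk> \<Longrightarrow> free_lift act f u \<in> A"
  by (auto elim!: free_actE intro!: act_closed)

lemma free_lift_action:
  "\<lbrakk>f \<in> X \<rightarrow> A; u \<in> free_act S X; s \<in> carrier S\<rbrakk>
    \<Longrightarrow> free_lift act f (free_action S u s) = act (free_lift act f u) s"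
  by (auto elim!: free_actE intro!: act_mult)

text \<open>The kernel is the pullback of equality on \<open>A\<close> along the lift.\<close>

lemma act_congruence_free_kernel:
  assumes "f \<in> X \<rightarrow> A"
  shows "act_congruence S (free_act S X) (free_action S) (free_kernel S X act f)"
proof -
  have "act_congruence S A act (Id_on A)"
    by (rule act_congruenceI)
      (auto simp: equiv_def refl_on_def sym_def trans_def act_closed)
  then have "act_congruence S (free_act S X) (free_action S)
      {(u, v). u \<in> free_act S X \<and> v \<in> free_act S X \<and> (free_lift act f u, free_lift act f v) \<in> Id_on A}"
    by (rule act_congruence_vimage[where \<iota> = id])
      (auto simp: free_action_closed free_lift_closed[OF assms] free_lift_action[OF assms])
  also have "{(u, v). u \<in> free_act S X \<and> v \<in> free_act S X \<and> (free_lift act f u, free_lift act f v) \<in> Id_on A}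
      = free_kernel S X act f"
    using free_lift_closed[OF assms] by (fastforce simp: free_kernel_def)
  finally show ?thesis .
qed

text \<open>First isomorphism theorem: the fibres of the surjective lift are exactly the kernel
  classes, so sending an element to its fibre is an isomorphism onto the quotient.\<close>

lemma act_fin_presented_if_free_kernel:
  fixes X :: "nat set"
  assumes X: "finite X" and f: "f \<in> X \<rightarrow> A" and gen: "free_lift act f ` free_act S X = A"
    and fg: "congruence_fin_generated S (free_act S X) (free_action S) (free_kernel S X act f)"
  shows "act_fin_presented S A act"
proof -
  let ?F = "free_act S X" and ?\<kappa> = "free_kernel S X act f" and ?l = "free_lift act f"
  define \<phi> where "\<phi> a = {u \<in> ?F. ?l u = a}" for a
  have \<phi>: "\<phi> (?l u) = ?\<kappa> `` {u}" if "u \<in> ?F" for u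
    using that by (auto simp: \<phi>_def free_kernel_def)
  have "act_iso S A act (?F // ?\<kappa>) (quotient_action (free_action S) ?\<kappa>) \<phi>"
    unfolding act_iso_def
  proof (intro conjI ballI)
    have "inj_on \<phi> A"
    proof (rule inj_onI)
      fix a b assume "a \<in> A" "b \<in> A" and eq: "\<phi> a = \<phi> b"
      then obtain u where "u \<in> ?F" "?l u = a" using gen by blast
      then have "u \<in> \<phi> b" using eq by (auto simp: \<phi>_def)
      with \<open>?l u = a\<close> show "a = b" by (simp add: \<phi>_def)
    qed
    moreover have "\<phi> ` A = ?F // ?\<kappa>"
      unfolding gen[symmetric] quotient_def using \<phi> by auto
    ultimately show "bij_betw \<phi> A (?F // ?\<kappa>)" by (simp add: bij_betw_def)
  next
    fix a s assume "a \<in> A" and s: "s \<in> carrier S"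
    then obtain u where u: "u \<in> ?F" and a: "a = ?l u" using gen by blast
    have "\<phi> (act a s) = \<phi> (?l (free_action S u s))"
      using free_lift_action[OF f u s] a by simp
    also have "\<dots> = ?\<kappa> `` {free_action S u s}" using free_action_closed[OF u s] by (rule \<phi>)
    also have "\<dots> = quotient_action (free_action S) ?\<kappa> (\<phi> a) s"
      using quotient_action_class[OF act_congruence_free_kernel[OF f] u s] a \<phi>[OF u] by simp
    finally show "\<phi> (act a s) = quotient_action (free_action S) ?\<kappa> (\<phi> a) s" .
  qed
  with X fg show ?thesis unfolding act_fin_presented_def by blast
qed

text \<open>Finite generation of the kernel does not depend on the generating family: the old relations
  are rewritten in the new generators, and one relation per new generator records that
  rewriting it in the old generators and back changes nothing.\<close>
lemma free_kernel_fin_generated: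
  assumes X: "finite X" and f: "f \<in> X \<rightarrow> A" and gen: "free_lift act f ` free_act S X = A"
    and fp: "act_fin_presented S A act"
  shows "congruence_fin_generated S (free_act S X) (free_action S) (free_kernel S X act f)"
proof -
  obtain Y :: "nat set" and \<rho> \<phi> where Y: "finite Y"
    and \<rho>: "congruence_fin_generated S (free_act S Y) (free_action S) \<rho>"
    and \<phi>: "act_iso S A act (free_act S Y // \<rho>) (quotient_action (free_action S) \<rho>) \<phi>"
    using fp unfolding act_fin_presented_def by blast
  have cong: "act_congruence S (free_act S Y) (free_action S) \<rho>"
    using \<rho> by (simp add: congruence_fin_generated_def)
  note eq = act_congruence_equiv[OF cong]
  obtain R where R: "finite R" "R \<subseteq> \<rho>"
    and least: "\<And>\<sigma>. \<lbrakk>act_congruence S (free_act S Y) (free_action S) \<sigma>; R \<subseteq> \<sigma>\<rbrakk> \<Longrightarrow> \<rho> \<subseteq> \<sigma>"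
    using \<rho> by (rule congruence_fin_generatedE) blast
  have bij: "bij_betw \<phi> A (free_act S Y // \<rho>)"
    and hom: "\<And>a s. a \<in> A \<Longrightarrow> s \<in> carrier S
      \<Longrightarrow> \<phi> (act a s) = quotient_action (free_action S) \<rho> (\<phi> a) s"
    using \<phi> by (auto simp: act_iso_def)
  let ?FX = "free_act S X" and ?FY = "free_act S Y"
  interpret FX: right_act S ?FX "free_action S" by (rule right_act_free) (rule monoid_axioms)
  interpret FY: right_act S ?FY "free_action S" by (rule right_act_free) (rule monoid_axioms)
  \<comment> \<open>\<open>p\<close> writes each generator \<open>f x\<close> as a word over
    \<open>Y\<close>; below, \<open>q\<close> writes each generator from \<open>Y\<close> as a word
    over \<open>X\<close>, which is possible by \<open>gen\<close>.\<close>
  have "\<exists>u\<in>?FY. \<phi> (f x) = \<rho> `` {u}" if "x \<in> X" for x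
    using f that bij_betwE[OF bij] by (fastforce elim!: quotientE)
  then obtain p where p: "p \<in> X \<rightarrow> ?FY" and \<phi>p: "\<And>x. x \<in> X \<Longrightarrow> \<phi> (f x) = \<rho> `` {p x}"
    by (metis Pi_I)
  have "\<exists>u\<in>?FX. \<phi> (free_lift act f u) = \<rho> `` {(y, \<one>)}" if "y \<in> Y" for y
  proof -
    have "\<rho> `` {(y, \<one>)} \<in> ?FY // \<rho>" using that by (auto intro: quotientI)
    then show ?thesis using bij gen unfolding bij_betw_def by (metis (no_types, lifting) imageE)
  qed
  then obtain q where q: "q \<in> Y \<rightarrow> ?FX"
    and \<phi>q: "\<And>y. y \<in> Y \<Longrightarrow> \<phi> (free_lift act f (q y)) = \<rho> `` {(y, \<one>)}"
    by (metis Pi_I)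
  let ?p = "free_lift (free_action S) p" and ?q = "free_lift (free_action S) q"
  have \<phi>p': "\<phi> (free_lift act f u) = \<rho> `` {?p u}" if "u \<in> ?FX" for u
    using that f p by (auto elim!: free_actE simp: hom \<phi>p Pi_iff quotient_action_class[OF cong])
  have \<phi>q': "\<phi> (free_lift act f (?q v)) = \<rho> `` {v}" if "v \<in> ?FY" for v
  proof -
    from that obtain y s where v: "v = (y, s)" "y \<in> Y" "s \<in> carrier S" by (rule free_actE)
    have qy: "q y \<in> ?FX" using q v by auto
    have "\<phi> (free_lift act f (?q v)) = quotient_action (free_action S) \<rho> (\<rho> `` {(y, \<one>)}) s"
      using v by (simp add: free_lift_action[OF f qy] hom free_lift_closed[OF f qy] \<phi>q)
    also have "\<dots> = \<rho> `` {v}" using v by (simp add: quotient_action_class[OF cong])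
    finally show ?thesis .
  qed
  have inj: "a = b" if "\<phi> a = \<phi> b" "a \<in> A" "b \<in> A" for a b
    using that bij by (auto simp: bij_betw_def inj_on_def)
  note p_closed = FY.free_lift_closed[OF p] and q_closed = FX.free_lift_closed[OF q]
  note l_closed = free_lift_closed[OF f]
  have qp: "free_lift act f (?q (?p u)) = free_lift act f u" if "u \<in> ?FX" for u
  proof (rule inj)
    show "\<phi> (free_lift act f (?q (?p u))) = \<phi> (free_lift act f u)"
      using \<phi>q'[OF p_closed[OF that]] \<phi>p'[OF that] by metis
  qed (use that in \<open>auto intro!: p_closed q_closed l_closed\<close>)
  define R' where
    "R' = (\<lambda>x. ((x, \<one>), ?q (?p (x, \<one>)))) ` X \<union> (\<lambda>(u, v). (?q u, ?q v)) ` R"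
  have "finite R'" using X R(1) by (simp add: R'_def)
  moreover have "R' \<subseteq> free_kernel S X act f"
  proof -
    have "(?q u, ?q v) \<in> free_kernel S X act f" if "(u, v) \<in> \<rho>" for u v
    proof -
      have uv: "u \<in> ?FY" "v \<in> ?FY" using eq that by (auto simp: equiv_def)
      then have "\<phi> (free_lift act f (?q u)) = \<phi> (free_lift act f (?q v))"
        using equiv_class_eq[OF eq that] by (simp add: \<phi>q')
      then have "free_lift act f (?q u) = free_lift act f (?q v)"
        by (rule inj) (simp_all add: l_closed q_closed uv)
      with uv show ?thesis by (simp add: free_kernel_def q_closed)
    qed
    moreover have "((x, \<one>), ?q (?p (x, \<one>))) \<in> free_kernel S X act f" if "x \<in> X" for x
    proof -
      have x: "(x, \<one>) \<in> ?FX" using that by simp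
      with q_closed[OF p_closed[OF x]] qp[OF x] show ?thesis by (simp add: free_kernel_def)
    qed
    ultimately show ?thesis using R(2) by (auto simp: R'_def simp del: free_lift_apply)
  qed
  moreover have "free_kernel S X act f \<subseteq> \<sigma>"
    if \<sigma>: "act_congruence S ?FX (free_action S) \<sigma>" and R': "R' \<subseteq> \<sigma>" for \<sigma>
  proof -
    note eq' = act_congruence_equiv[OF \<sigma>]
    \<comment> \<open>The pullback of \<open>\<sigma>\<close> along the lift of \<open>q\<close> is
      a congruence containing \<open>R\<close>, hence all of \<open>\<rho>\<close>.\<close>
    have "\<rho> \<subseteq> {(u, v). u \<in> ?FY \<and> v \<in> ?FY \<and> (?q u, ?q v) \<in> \<sigma>}"
    proof (rule least)
      show "act_congruence S ?FY (free_action S) {(u, v). u \<in> ?FY \<and> v \<in> ?FY \<and> (?q u, ?q v) \<in> \<sigma>}"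
        by (rule act_congruence_vimage[OF \<sigma>, where \<iota> = id])
          (auto simp: free_action_closed q_closed FX.free_lift_action[OF q])
      show "R \<subseteq> {(u, v). u \<in> ?FY \<and> v \<in> ?FY \<and> (?q u, ?q v) \<in> \<sigma>}"
        using R(2) R' eq by (auto simp: R'_def equiv_def)
    qed
    then have q\<sigma>: "(?q u, ?q v) \<in> \<sigma>" if "(u, v) \<in> \<rho>" for u v using that by blast
    \<comment> \<open>\<open>R'\<close> gives this at \<open>(x, \<one>)\<close>; acting by
      \<open>s\<close> gives it at \<open>(x, s)\<close>, since both lifts commute with the
      action.\<close>
    have qp\<sigma>: "(u, ?q (?p u)) \<in> \<sigma>" if "u \<in> ?FX" for u
    proof -
      from that obtain x s where u: "u = (x, s)" "x \<in> X" "s \<in> carrier S" by (rule free_actE)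
      have x: "(x, \<one>) \<in> ?FX" using u by simp
      have "((x, \<one>), ?q (?p (x, \<one>))) \<in> \<sigma>" using R' u by (auto simp: R'_def)
      then have "(free_action S (x, \<one>) s, free_action S (?q (?p (x, \<one>))) s) \<in> \<sigma>"
        using u by (intro act_congruence_act[OF \<sigma>])
      moreover have "free_action S (x, \<one>) s = u" using u by simp
      moreover have "free_action S (?q (?p (x, \<one>))) s = ?q (?p (free_action S (x, \<one>) s))"
        unfolding FY.free_lift_action[OF p x u(3)] FX.free_lift_action[OF q p_closed[OF x] u(3)] ..
      ultimately show ?thesis by simp
    qed
    show ?thesis
    proof clarify
      fix x s y t
      assume "((x, s), (y, t)) \<in> free_kernel S X act f"
      moreover define u v where "u = (x, s)" and "v = (y, t)"
      ultimately have uv: "u \<in> ?FX" "v \<in> ?FX" and "free_lift act f u = free_lift act f v"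
        by (auto simp: free_kernel_def)
      then have "\<rho> `` {?p u} = \<rho> `` {?p v}" using \<phi>p'[of u] \<phi>p'[of v] by simp
      then have "(?p u, ?p v) \<in> \<rho>"
        using eq_equiv_class[OF _ eq] p_closed uv by blast
      then have "(?q (?p u), ?q (?p v)) \<in> \<sigma>" by (rule q\<sigma>)
      \<comment> \<open>The chain is \<open>u\<close>, \<open>?q (?p u)\<close>,
        \<open>?q (?p v)\<close>, \<open>v\<close>.\<close>
      with qp\<sigma>[OF uv(1)] qp\<sigma>[OF uv(2)] eq' have "(u, v) \<in> \<sigma>"
        unfolding equiv_def by (meson symD transD)
      then show "((x, s), (y, t)) \<in> \<sigma>" by (simp add: u_def v_def)
    qed
  qed
  ultimately show ?thesis
    unfolding congruence_fin_generated_def using act_congruence_free_kernel[OF f] by blast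
qed

end


subsection \<open>Congruences over a Bruck--Reilly extension\<close>

lemma bruck_reilly_carrier [simp]: "(a, g, b) \<in> carrier (bruck_reilly M \<theta>) \<longleftrightarrow> g \<in> carrier M"
  by (simp add: bruck_reilly_def)

lemma bruck_reilly_mult_le:
  "c \<le> b \<Longrightarrow> (a, g, b) \<otimes>\<^bsub>bruck_reilly M \<theta>\<^esub> (c, h, d) = (a, g \<otimes>\<^bsub>M\<^esub> (\<theta> ^^ (b - c)) h, d + (b - c))"
  by (simp add: bruck_reilly_def max_def)

lemma bruck_reilly_mult_gt:
  "b < c \<Longrightarrow> (a, g, b) \<otimes>\<^bsub>bruck_reilly M \<theta>\<^esub> (c, h, d) = (a + (c - b), (\<theta> ^^ (c - b)) g \<otimes>\<^bsub>M\<^esub> h, d)"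
  by (simp add: bruck_reilly_def max_def)

text \<open>The condition \<open>b = d\<close> ensures that a factor reaches both middle components
  through the same power of \<open>\<theta>\<close>. The second set is a single class; its
  membership conditions keep it inside the free act.\<close>

definition bruck_reilly_congruence ::
    "('a, 'm) monoid_scheme \<Rightarrow> 'x set \<Rightarrow> (('x \<times> 'a) \<times> ('x \<times> 'a)) set
      \<Rightarrow> (('x \<times> nat \<times> 'a \<times> nat) \<times> ('x \<times> nat \<times> 'a \<times> nat)) set" where
  "bruck_reilly_congruence M X \<rho> =
     {((x, a, g, b), (y, c, h, d)). a = 0 \<and> c = 0 \<and> b = d \<and> ((x, g), (y, h)) \<in> \<rho>} \<union>
     {((x, a, g, b), (y, c, h, d)). 0 < a \<and> 0 < c \<and> x \<in> X \<and> y \<in> X \<and> g \<in> carrier M \<and> h \<in> carrier M}"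

lemma mem_bruck_reilly_congruence:
  "((x, a, g, b), (y, c, h, d)) \<in> bruck_reilly_congruence M X \<rho> \<longleftrightarrow>
     a = 0 \<and> c = 0 \<and> b = d \<and> ((x, g), (y, h)) \<in> \<rho> \<or>
     0 < a \<and> 0 < c \<and> x \<in> X \<and> y \<in> X \<and> g \<in> carrier M \<and> h \<in> carrier M"
  by (simp add: bruck_reilly_congruence_def)

text \<open>A factor \<open>(i, k, j)\<close> with \<open>i \<le> b\<close> multiplies both middle
  components of a pair from the first set by the same element of \<open>M\<close>; with
  \<open>i > b\<close> it sends both sides into the collapsed class, which no factor can
  leave.\<close>

lemma act_congruence_bruck_reilly:
  assumes M: "monoid M" and \<theta>: "monoid_endo M \<theta>"
    and \<rho>: "act_congruence M (free_act M X) (free_action M) \<rho>"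
  defines "S \<equiv> bruck_reilly M \<theta>"
  shows "act_congruence S (free_act S X) (free_action S) (bruck_reilly_congruence M X \<rho>)"
proof (rule act_congruenceI)
  interpret M: monoid M by (rule M)
  have \<theta>_closed: "(\<theta> ^^ n) g \<in> carrier M" if "g \<in> carrier M" for n g
    using monoid_endo_funpow[OF M \<theta>, of n] that by (auto simp: monoid_endo_def hom_def)
  let ?\<tau> = "bruck_reilly_congruence M X \<rho>"
  have sub: "\<rho> \<subseteq> free_act M X \<times> free_act M X" and refl: "refl_on (free_act M X) \<rho>"
    and sym: "sym \<rho>" and trans: "trans \<rho>"
    using act_congruence_equiv[OF \<rho>] by (auto simp: equiv_def)
  show "equiv (free_act S X) ?\<tau>"
  proof (rule equivI)
    show "?\<tau> \<subseteq> free_act S X \<times> free_act S X"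
      using sub by (auto simp: bruck_reilly_congruence_def S_def)
    show "refl_on (free_act S X) ?\<tau>"
      using refl by (auto simp: refl_on_def S_def mem_bruck_reilly_congruence free_act_def bruck_reilly_def)
    show "sym ?\<tau>"
      by (rule symI) (auto simp: mem_bruck_reilly_congruence dest: symD[OF sym])
    show "trans ?\<tau>"
      by (rule transI) (auto simp: mem_bruck_reilly_congruence dest: transD[OF trans])
  qed
  fix u v s
  assume "(u, v) \<in> ?\<tau>" "s \<in> carrier S"
  moreover obtain x a g b y c h d where "u = (x, a, g, b)" "v = (y, c, h, d)"
    by (metis prod_cases4)
  moreover obtain i k j where "s = (i, k, j)" by (metis prod_cases3)
  ultimately have uv: "u = (x, a, g, b)" "v = (y, c, h, d)" and s: "s = (i, k, j)" "k \<in> carrier M"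
    and \<tau>: "((x, a, g, b), (y, c, h, d)) \<in> ?\<tau>"
    by (auto simp: S_def)
  \<comment> \<open>The first coordinate never decreases, so the collapsed class is closed under the
    action.\<close>
  have pos: "\<exists>a' g' b'. (a, g, b) \<otimes>\<^bsub>S\<^esub> s = (a', g', b') \<and> a \<le> a' \<and> g' \<in> carrier M"
    if "g \<in> carrier M" for a g b
    using that s by (cases "i \<le> b") (auto simp: S_def bruck_reilly_mult_le bruck_reilly_mult_gt \<theta>_closed)
  show "(free_action S u s, free_action S v s) \<in> ?\<tau>"
  proof (cases "a = 0")
    case True
    then have 0: "a = 0" "c = 0" "d = b" and gh: "((x, g), (y, h)) \<in> \<rho>"
      using \<tau> by (auto simp: mem_bruck_reilly_congruence)
    have car: "g \<in> carrier M" "h \<in> carrier M" "x \<in> X" "y \<in> X" using gh sub by auto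
    show ?thesis
    proof (cases "i \<le> b")
      case True
      have "((x, g \<otimes>\<^bsub>M\<^esub> (\<theta> ^^ (b - i)) k), (y, h \<otimes>\<^bsub>M\<^esub> (\<theta> ^^ (b - i)) k)) \<in> \<rho>"
        using act_congruence_act[OF \<rho> gh \<theta>_closed[OF s(2), of "b - i"]] by simp
      then show ?thesis
        using True by (simp add: uv s 0 S_def bruck_reilly_mult_le mem_bruck_reilly_congruence)
    next
      case False
      then show ?thesis using car
        by (simp add: uv s 0 S_def bruck_reilly_mult_gt mem_bruck_reilly_congruence \<theta>_closed)
    qed
  next
    case False
    then have "0 < a" "0 < c" and car: "g \<in> carrier M" "h \<in> carrier M" "x \<in> X" "y \<in> X"
      using \<tau> by (auto simp: mem_bruck_reilly_congruence)
    then show ?thesis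
      using pos[OF car(1), of a b] pos[OF car(2), of c d]
      by (auto simp: uv mem_bruck_reilly_congruence)
  qed
qed


subsection \<open>Descent of coherence\<close>

theorem corollary4p11:
  fixes M :: "'a monoid" and \<theta> :: "'a \<Rightarrow> 'a"
  assumes "monoid M" and "monoid_endo M \<theta>"
    and "right_coherent (bruck_reilly M \<theta>)"
  shows "right_coherent M"
  unfolding right_coherent_def
proof (intro allI impI, elim conjE)
  fix A :: "(nat \<times> 'a) set set" and act B
  assume A: "right_act M A act" and fp: "act_fin_presented M A act"
    and B: "subact M A act B" and fgB: "act_fin_generated M B act"
  define S where "S = bruck_reilly M \<theta>"
  have S: "monoid S" and coh: "right_coherent S"
    using monoid_bruck_reilly[OF assms(1,2)] assms(3) by (simp_all add: S_def)
  interpret M: monoid M by fact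
  interpret S: monoid S by (rule S)
  interpret A: right_act M A act by (rule A)
  interpret B: right_act M B act
    using B by unfold_locales (auto simp: subact_def A.act_one A.act_mult)
  \<comment> \<open>\<open>emb\<close> embeds \<open>M\<close> in \<open>S\<close> as a submonoid,
    and \<open>embF\<close> is the induced map of free acts.\<close>
  define emb :: "'a \<Rightarrow> nat \<times> 'a \<times> nat" where "emb g = (0, g, 0)" for g
  define embF :: "nat \<times> 'a \<Rightarrow> nat \<times> nat \<times> 'a \<times> nat" where "embF = map_prod id emb"
  have embF_eq: "embF (x, g) = (x, 0, g, 0)" for x g by (simp add: embF_def emb_def)
  have emb_closed: "emb g \<in> carrier S" if "g \<in> carrier M" for g
    using that by (simp add: emb_def S_def)
  have mult_0: "(0, g, 0) \<otimes>\<^bsub>S\<^esub> (0, h, b) = (0, g \<otimes>\<^bsub>M\<^esub> h, b)" for g h b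
    by (simp add: S_def bruck_reilly_mult_le)
  have embF_closed: "embF u \<in> free_act S X" if "u \<in> free_act M X" for u X
    using that by (auto elim!: free_actE simp: embF_eq S_def)
  have embF_hom: "embF (free_action M u g) = free_action S (embF u) (emb g)" for u g
    by (cases u) (simp add: embF_eq emb_def mult_0)
  note \<tau>_cong = act_congruence_bruck_reilly[OF assms(1,2), folded S_def]

  \<comment> \<open>A finite presentation of the given act over \<open>M\<close>\<close>
  obtain X :: "nat set" and \<rho> \<phi> where X: "finite X"
    and \<rho>: "congruence_fin_generated M (free_act M X) (free_action M) \<rho>"
    and \<phi>: "act_iso M A act (free_act M X // \<rho>) (quotient_action (free_action M) \<rho>) \<phi>"
    using fp unfolding act_fin_presented_def by blast
  let ?FX = "free_act M X" and ?SX = "free_act S X"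
  interpret SX: right_act S ?SX "free_action S" by (rule right_act_free) (rule S)
  have \<rho>_cong: "act_congruence M ?FX (free_action M) \<rho>"
    using \<rho> by (simp add: congruence_fin_generated_def)
  note \<rho>_eq = act_congruence_equiv[OF \<rho>_cong]
  obtain R where R: "finite R" "R \<subseteq> \<rho>"
    and R_least: "\<And>\<sigma>. \<lbrakk>act_congruence M ?FX (free_action M) \<sigma>; R \<subseteq> \<sigma>\<rbrakk> \<Longrightarrow> \<rho> \<subseteq> \<sigma>"
    using \<rho> by (rule congruence_fin_generatedE) blast
  have bij: "bij_betw \<phi> A (?FX // \<rho>)"
    and \<phi>_hom: "\<And>a s. a \<in> A \<Longrightarrow> s \<in> carrier M
      \<Longrightarrow> \<phi> (act a s) = quotient_action (free_action M) \<rho> (\<phi> a) s"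
    using \<phi> by (auto simp: act_iso_def)

  \<comment> \<open>The act over \<open>S\<close> with the same presentation\<close>
  define \<sigma> where "\<sigma> = congruence_generated S ?SX (free_action S) (map_prod embF embF ` R)"
  let ?Q = "?SX // \<sigma>" and ?q = "quotient_action (free_action S) \<sigma>"
  have R_sub: "map_prod embF embF ` R \<subseteq> ?SX \<times> ?SX"
  proof -
    have "R \<subseteq> ?FX \<times> ?FX" using R(2) \<rho>_eq by (auto simp: equiv_def)
    then show ?thesis using embF_closed by (auto simp del: mem_free_act)
  qed
  have \<sigma>_cong: "act_congruence S ?SX (free_action S) \<sigma>"
    unfolding \<sigma>_def by (rule SX.act_congruence_generated[OF R_sub])
  note \<sigma>_eq = act_congruence_equiv[OF \<sigma>_cong]
  have Q: "right_act S ?Q ?q" by (rule right_act_quotient[OF SX.right_act_axioms \<sigma>_cong])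
  interpret Q: right_act S ?Q ?q by (rule Q)
  have "act_iso S ?Q ?q ?Q ?q id" by (simp add: act_iso_def)
  moreover have "congruence_fin_generated S ?SX (free_action S) \<sigma>"
    unfolding \<sigma>_def using R(1) R_sub by (intro SX.congruence_fin_generated_generated) auto
  ultimately have Q_fp: "act_fin_presented S ?Q ?q"
    unfolding act_fin_presented_def using X by blast
  \<comment> \<open>The pullback of \<open>\<sigma>\<close> along \<open>embF\<close> is a
    congruence over \<open>M\<close> containing \<open>R\<close>. Together with the bound on
    \<open>\<sigma>\<close> below, it follows that \<open>\<sigma>\<close> restricts to exactly
    \<open>\<rho>\<close> on the image of \<open>embF\<close>.\<close>
  have \<rho>\<sigma>: "(embF u, embF v) \<in> \<sigma>" if "(u, v) \<in> \<rho>" for u v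
  proof -
    have "\<rho> \<subseteq> {(u, v). u \<in> ?FX \<and> v \<in> ?FX \<and> (embF u, embF v) \<in> \<sigma>}"
    proof (rule R_least)
      show "act_congruence M ?FX (free_action M) {(u, v). u \<in> ?FX \<and> v \<in> ?FX \<and> (embF u, embF v) \<in> \<sigma>}"
        by (rule act_congruence_vimage[OF \<sigma>_cong, where \<iota> = emb])
          (auto simp: embF_closed emb_closed embF_hom elim!: free_actE)
      show "R \<subseteq> {(u, v). u \<in> ?FX \<and> v \<in> ?FX \<and> (embF u, embF v) \<in> \<sigma>}"
        using R(2) \<rho>_eq congruence_generated_incl[of "map_prod embF embF ` R" S ?SX "free_action S"]
        by (force simp: \<sigma>_def equiv_def)
    qed
    then show ?thesis using that by blast
  qed
  have \<sigma>\<tau>: "\<sigma> \<subseteq> bruck_reilly_congruence M X \<rho>"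
    unfolding \<sigma>_def
  proof (rule congruence_generated_least[OF \<tau>_cong[OF \<rho>_cong]])
    show "map_prod embF embF ` R \<subseteq> bruck_reilly_congruence M X \<rho>"
      using R(2) by (auto simp: embF_eq mem_bruck_reilly_congruence)
  qed

  \<comment> \<open>Generators of the subact and their copies over \<open>S\<close>\<close>
  obtain G where G: "finite G" "G \<subseteq> B" "B = (\<Union>a\<in>G. {act a s | s. s \<in> carrier M})"
    using fgB by (auto simp: act_fin_generated_def)
  \<comment> \<open>The generators are indexed by naturals because finite presentations take their
    generating sets in \<open>nat\<close>.\<close>
  obtain n and e :: "nat \<Rightarrow> (nat \<times> 'a) set" where e_G: "G = e ` {i. i < n}"
    using finite_imp_nat_seg_image_inj_on[OF G(1)] by blast
  define Y where "Y = {i. i < n}"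
  have Y: "finite Y" by (simp add: Y_def)
  have e: "e \<in> Y \<rightarrow> B" using G(2) e_G by (auto simp: Y_def)
  have e_gen: "free_lift act e ` free_act M Y = B"
    unfolding G(3) e_G Y_def[symmetric] by (force simp: free_act_def image_iff)
  have e_A: "e y \<in> A" if "y \<in> Y" for y using that e B by (auto simp: subact_def)
  have "\<exists>u\<in>?FX. \<phi> (e y) = \<rho> `` {u}" if "y \<in> Y" for y
    using e_A[OF that] bij_betwE[OF bij] by (fastforce elim!: quotientE)
  then obtain w where w: "\<And>y. y \<in> Y \<Longrightarrow> w y \<in> ?FX" and \<phi>w: "\<And>y. y \<in> Y \<Longrightarrow> \<phi> (e y) = \<rho> `` {w y}"
    by metis
  \<comment> \<open>\<open>w y\<close> is a word representing the generator \<open>e y\<close>, and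
    \<open>k y\<close> is the element of \<open>?Q\<close> represented by the same word.\<close>
  define k where "k y = \<sigma> `` {embF (w y)}" for y
  have k: "k \<in> Y \<rightarrow> ?Q" unfolding k_def by (intro Pi_I quotientI embF_closed w)
  define C where "C = free_lift ?q k ` free_act S Y"
  let ?KM = "free_kernel M Y act e" and ?KS = "free_kernel S Y ?q k"
  let ?FY = "free_act M Y" and ?SY = "free_act S Y"
  interpret SY: right_act S ?SY "free_action S" by (rule right_act_free) (rule S)

  \<comment> \<open>Comparison of the kernels over \<open>M\<close> and over
    \<open>S\<close>\<close>
  have KM_iff: "((y, g), (z, h)) \<in> ?KM \<longleftrightarrow> (free_action M (w y) g, free_action M (w z) h) \<in> \<rho>"
    if "y \<in> Y" "z \<in> Y" "g \<in> carrier M" "h \<in> carrier M" for y z g h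
  proof -
    have *: "\<phi> (act (e y) g) = \<rho> `` {free_action M (w y) g}" if "y \<in> Y" "g \<in> carrier M" for y g
      using that by (simp add: \<phi>_hom e_A \<phi>w quotient_action_class[OF \<rho>_cong] w)
    have cl: "free_action M (w y) g \<in> ?FX" if "y \<in> Y" "g \<in> carrier M" for y g
      using w[OF that(1)] that by (auto elim!: free_actE)
    have "((y, g), (z, h)) \<in> ?KM \<longleftrightarrow> \<phi> (act (e y) g) = \<phi> (act (e z) h)"
      using that bij_betw_imp_inj_on[OF bij] e_A
      by (auto simp: free_kernel_def inj_on_eq_iff A.act_closed)
    also have "\<dots> \<longleftrightarrow> (free_action M (w y) g, free_action M (w z) h) \<in> \<rho>"
      using that by (simp add: * cl eq_equiv_class_iff[OF \<rho>_eq])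
    finally show ?thesis .
  qed
  have KS_iff: "((y, s), (z, t)) \<in> ?KS \<longleftrightarrow>
      (free_action S (embF (w y)) s, free_action S (embF (w z)) t) \<in> \<sigma>"
    if "y \<in> Y" "z \<in> Y" "s \<in> carrier S" "t \<in> carrier S" for y z s t
    using that
    by (simp add: free_kernel_def k_def quotient_action_class[OF \<sigma>_cong] w embF_closed
        eq_equiv_class_iff[OF \<sigma>_eq] SX.act_closed)
  \<comment> \<open>By \<open>\<sigma>\<tau>\<close> a relation of \<open>?KS\<close> becomes a pair
    of \<open>bruck_reilly_congruence M X \<rho>\<close>, which never mixes \<open>a = 0\<close>
    with \<open>a > 0\<close> and at \<open>a = 0\<close> keeps \<open>b\<close> and restricts the
    middle components by \<open>\<rho>\<close>.\<close>
  have KS_KM: "a = 0 \<longleftrightarrow> c = 0" "a = 0 \<Longrightarrow> b = d \<and> ((y, g), (z, h)) \<in> ?KM"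
    if "((y, a, g, b), (z, c, h, d)) \<in> ?KS" for y a g b z c h d
  proof -
    have yz: "y \<in> Y" "z \<in> Y" "g \<in> carrier M" "h \<in> carrier M"
      using that by (auto simp: free_kernel_def S_def)
    obtain x m x' m' where wyz: "w y = (x, m)" "w z = (x', m')" by (metis surj_pair)
    have "(free_action S (embF (w y)) (a, g, b), free_action S (embF (w z)) (c, h, d)) \<in> \<sigma>"
      using that yz by (subst KS_iff[symmetric]) (auto simp: S_def)
    then have *: "((x, (0, m, 0) \<otimes>\<^bsub>S\<^esub> (a, g, b)), (x', (0, m', 0) \<otimes>\<^bsub>S\<^esub> (c, h, d)))
        \<in> bruck_reilly_congruence M X \<rho>"
      using \<sigma>\<tau> by (auto simp: wyz embF_eq)
    \<comment> \<open>Left multiplication by \<open>(0, m, 0)\<close> preserves the first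
      coordinate, so \<open>a\<close> and \<open>c\<close> decide which of the two sets contains the
      pair.\<close>
    have mult_pos: "\<exists>g' b'. (0, m, 0) \<otimes>\<^bsub>S\<^esub> (a, g, b) = (a, g', b')" for m a g b
      by (cases "a = 0") (auto simp: S_def bruck_reilly_mult_le bruck_reilly_mult_gt)
    show iff: "a = 0 \<longleftrightarrow> c = 0"
      using * mult_pos[of m a g b] mult_pos[of m' c h d] by (auto simp: mem_bruck_reilly_congruence)
    show "b = d \<and> ((y, g), (z, h)) \<in> ?KM" if "a = 0"
      using * that iff yz by (auto simp: KM_iff wyz mult_0 mem_bruck_reilly_congruence)
  qed
  have KM_KS: "(embF u, embF v) \<in> ?KS" if "(u, v) \<in> ?KM" for u v
  proof -
    obtain y g z h where uv: "u = (y, g)" "v = (z, h)" by (metis surj_pair)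
    have yz: "y \<in> Y" "z \<in> Y" "g \<in> carrier M" "h \<in> carrier M"
      using that by (auto simp: uv free_kernel_def)
    have "(embF (free_action M (w y) g), embF (free_action M (w z) h)) \<in> \<sigma>"
      using that yz by (intro \<rho>\<sigma>) (simp add: uv KM_iff)
    then show ?thesis
      using yz emb_closed by (simp add: embF_hom uv embF_eq KS_iff emb_def)
  qed

  \<comment> \<open>Coherence of \<open>S\<close> applied to the subact generated by the
    copies\<close>
  have k_C: "k \<in> Y \<rightarrow> C"
  proof
    fix y assume y: "y \<in> Y"
    then have "k y \<in> ?Q" using k by blast
    then have "free_lift ?q k (y, \<one>\<^bsub>S\<^esub>) = k y" using Q.act_one by simp
    moreover have "(y, \<one>\<^bsub>S\<^esub>) \<in> ?SY" using y by simp
    ultimately show "k y \<in> C" unfolding C_def by (metis image_eqI)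
  qed
  have C: "subact S ?Q ?q C"
    unfolding subact_def C_def
  proof (intro conjI ballI)
    show "free_lift ?q k ` ?SY \<subseteq> ?Q" using Q.free_lift_closed[OF k] by blast
    fix a s assume "a \<in> free_lift ?q k ` ?SY" and s: "s \<in> carrier S"
    then obtain u where u: "u \<in> ?SY" "a = free_lift ?q k u" by blast
    then have "?q a s = free_lift ?q k (free_action S u s)"
      using Q.free_lift_action[OF k u(1) s] by simp
    with SY.act_closed[OF u(1) s] show "?q a s \<in> free_lift ?q k ` ?SY" by simp
  qed
  have "act_fin_generated S C ?q"
    unfolding act_fin_generated_def
  proof (intro exI conjI)
    show "finite (k ` Y)" using Y by simp
    show "k ` Y \<subseteq> C" using k_C by blast
    show "C = (\<Union>a\<in>k ` Y. {?q a s | s. s \<in> carrier S})"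
      by (force simp: C_def free_act_def image_iff)
  qed
  then have C_fp: "act_fin_presented S C ?q" by (rule right_coherentD[OF coh Q Q_fp C])
  interpret C: right_act S C ?q
    using C by unfold_locales (auto simp: subact_def Q.act_one Q.act_mult)
  \<comment> \<open>Coherence supplies some presentation of \<open>C\<close>; finite generation
    passes from it to the kernel of the chosen generators \<open>k\<close>.\<close>
  have "congruence_fin_generated S ?SY (free_action S) ?KS"
    by (rule C.free_kernel_fin_generated[OF Y k_C C_def[symmetric] C_fp])
  then obtain H where H: "finite H" "H \<subseteq> ?KS"
    and H_least: "\<And>\<omega>. \<lbrakk>act_congruence S ?SY (free_action S) \<omega>; H \<subseteq> \<omega>\<rbrakk> \<Longrightarrow> ?KS \<subseteq> \<omega>"
    by (rule congruence_fin_generatedE) blast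

  \<comment> \<open>Finitely many relations presenting the subact over \<open>M\<close>\<close>
  define H' where "H' = (\<lambda>((y, a, g, b), (z, c, h, d)). ((y, g), (z, h))) `
    {((y, a, g, b), (z, c, h, d)) \<in> H. a = 0}"
  have H'I: "((y, g), (z, h)) \<in> H'" if "((y, 0, g, b), (z, c, h, d)) \<in> H" for y g b z c h d
    using that by (force simp: H'_def)
  have "finite H'"
    unfolding H'_def using H(1) by (intro finite_imageI) (auto elim!: rev_finite_subset)
  moreover have "H' \<subseteq> ?KM"
    using H(2) KS_KM(2) by (fastforce simp: H'_def)
  moreover have "?KM \<subseteq> \<omega>"
    if \<omega>: "act_congruence M ?FY (free_action M) \<omega>" and H'\<omega>: "H' \<subseteq> \<omega>" for \<omega>
  proof -
    \<comment> \<open>Extending \<open>\<omega>\<close> to a congruence over \<open>S\<close> makes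
      the minimality of \<open>?KS\<close> over \<open>H\<close> available.\<close>
    have "?KS \<subseteq> bruck_reilly_congruence M Y \<omega>"
    proof (rule H_least[OF \<tau>_cong[OF \<omega>]])
      show "H \<subseteq> bruck_reilly_congruence M Y \<omega>"
      proof clarify
        fix y a g b z c h d
        assume *: "((y, a, g, b), (z, c, h, d)) \<in> H"
        then have KS: "((y, a, g, b), (z, c, h, d)) \<in> ?KS" using H(2) by blast
        \<comment> \<open>For \<open>a > 0\<close> also \<open>c > 0\<close>, and the pair lies in
          the collapsed class whatever \<open>\<omega>\<close> is. For \<open>a = 0\<close>,
          \<open>KS_KM\<close> gives \<open>c = 0\<close> and \<open>b = d\<close>, and the middle
          components are related by \<open>H'\<close>.\<close>
        show "((y, a, g, b), (z, c, h, d)) \<in> bruck_reilly_congruence M Y \<omega>"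
          using KS_KM[OF KS] KS H'I[of y g b z c h d] * H'\<omega>
          by (auto simp: mem_bruck_reilly_congruence free_kernel_def S_def)
      qed
    qed
    \<comment> \<open>A relation of \<open>?KM\<close> enters \<open>?KS\<close> through
      \<open>embF\<close>, where the outer coordinates are zero, so membership in the extended
      congruence reduces to \<open>\<omega>\<close>.\<close>
    then have "(u, v) \<in> \<omega>" if "(u, v) \<in> ?KM" for u v
      using KM_KS[OF that] by (cases u; cases v) (auto simp: embF_eq mem_bruck_reilly_congruence)
    then show ?thesis by auto
  qed
  ultimately have "congruence_fin_generated M ?FY (free_action M) ?KM"
    unfolding congruence_fin_generated_def using B.act_congruence_free_kernel[OF e] by blast
  then show "act_fin_presented M B act"
    by (rule B.act_fin_presented_if_free_kernel[OF Y e e_gen])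
qed

end
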